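(* Let $P\in\mathbb{Z}[x]$ be a monic polynomial of degree $d$ and let $n\in\mathbb{Z}_{>1}$ have $l$ distinct prime factors. Then $$|U(n)|\ \le\ 2^{d^{2^l}}\,M(P)^{\,d^{2^l}\sum_{m\in\mathcal{D}_+(n)}m}.$$
   Context: Let $\alpha_1,\dots,\alpha_d$ be the roots of $P$ (with multiplicity) and $M(P)=\prod_j\max\{1,|\alpha_j|\}$ its Mahler measure. For $n>1$ let $\mathcal{D}_+(n)=\{m\mid n:\mu(n/m)=1\}$ and $\mathcal{D}_-(n)=\{m\mid n:\mu(n/m)=-1\}$ ($\mu$ the Möbius function); each has $r=2^{l-1}$ elements. For a multiset $\mathcal{N}=\{n_1,\dots,n_r\}$ of positive integers let $P_{\mathcal{N}}(x)=\prod_{j_1,\dots,j_r=1}^d(x-\alpha_{j_1}^{n_1}\cdots\alpha_{j_r}^{n_r})\in\mathbb{Z}[x]$. Then $U(n):=\operatorname{Res}(P_{\mathcal{D}_+(n)},P_{\mathcal{D}_-(n)})$, where for monic $A,B$, $\operatorname{Res}(A,B)=\prod_{A(a)=0,B(b)=0}(a-b)$. *)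

theory Defs
  imports
    "HOL-Library.FuncSet"
    "HOL-Library.Multiset"
    "HOL-Computational_Algebra.Computational_Algebra"
    "Berlekamp_Zassenhaus.Mahler_Measure"
begin

definition moebius :: "nat \<Rightarrow> int" where
  "moebius n = (if squarefree n then (-1) ^ card (prime_factors n) else 0)"

definition D_plus :: "nat \<Rightarrow> nat set" where
  "D_plus n = {m. m dvd n \<and> moebius (n div m) = 1}"

definition D_minus :: "nat \<Rightarrow> nat set" where
  "D_minus n = {m. m dvd n \<and> moebius (n div m) = -1}"

(* complex_roots_int P lists the complex roots of P with multiplicity, and n_1, ..., n_r are
   the elements of N in increasing order.  Neither ordering matters: reordering the roots or
   the n_i only permutes the index functions j. *)
definition power_product_poly :: "int poly \<Rightarrow> nat multiset \<Rightarrow> complex poly" where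
  "power_product_poly P N =
     (let \<alpha> = complex_roots_int P; ns = sorted_list_of_multiset N; r = size N
      in \<Prod>j \<in> {..<r} \<rightarrow>\<^sub>E {..<degree P}. [: - (\<Prod>i<r. (\<alpha> ! j i) ^ (ns ! i)), 1 :])"

(* Meant for monic A and B over the complex numbers; roots are taken with multiplicity. *)
definition monic_res :: "complex poly \<Rightarrow> complex poly \<Rightarrow> complex" where
  "monic_res A B = (\<Prod>a \<in># proots A. \<Prod>b \<in># proots B. a - b)"

definition U :: "int poly \<Rightarrow> nat \<Rightarrow> complex" where
  "U P n = monic_res (power_product_poly P (mset_set (D_plus n)))
                     (power_product_poly P (mset_set (D_minus n)))"

end

theory Submission
  imports Defs
begin

text \<open>The resultant is a product of \<open>d\<close> to the power \<open>2\<^sup>l\<close> differences \<open>a - b\<close> of power products of the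
  roots of \<open>P\<close>, each bounded by \<open>2 max {\<bar>a\<bar>, \<bar>b\<bar>}\<close>. Every root is bounded by \<open>M(P)\<close>, so \<open>\<bar>a\<bar>\<close> and
  \<open>\<bar>b\<bar>\<close> are at most \<open>M(P)\<close> raised to the sum of \<open>D_plus n\<close> resp. \<open>D_minus n\<close>, and the former sum is
  the larger one, because their difference is \<open>\<Sum>m|n. \<mu>(n/m) m = n \<Prod>p|n. (1 - 1/p) \<ge> 0\<close>.\<close>

section \<open>Squarefree divisors and sets of primes\<close>

lemma prime_factors_prod_primes:
  fixes S :: "nat set"
  assumes "finite S" and "\<And>p. p \<in> S \<Longrightarrow> prime p"
  shows "prime_factors (\<Prod>S) = S"
  using assms
proof (induction S rule: finite_induct)
  case (insert p S)
  have "\<Prod>S \<noteq> 0"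
    using insert by (metis insertI2 not_prime_0 prod_zero_iff)
  with insert show ?case
    by (auto simp: prime_factors_product prime_factorization_prime prime_gt_0_nat)
qed simp

lemma squarefree_prod_primes:
  fixes S :: "nat set"
  assumes "\<And>p. p \<in> S \<Longrightarrow> prime p"
  shows "squarefree (\<Prod>S)"
  using assms by (intro squarefree_prod_coprime) (auto intro: primes_coprime squarefree_prime)

lemma prod_prime_factors_squarefree:
  fixes n :: nat
  assumes "squarefree n"
  shows "\<Prod>(prime_factors n) = n"
proof -
  have n: "n \<noteq> 0"
    using assms by (metis not_squarefree_0)
  have "(\<Prod>p\<in>prime_factors n. p ^ multiplicity p n) = n"
    using prod_prime_factors[OF n] by simp
  moreover have "multiplicity p n = 1" if "p \<in> prime_factors n" for p
    using assms that squarefree_factorial_semiring'[OF n] by blast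
  ultimately show ?thesis
    by simp
qed

lemma prod_primes_dvd:
  fixes n :: nat
  assumes "n > 0" and "S \<subseteq> prime_factors n"
  shows "\<Prod>S dvd n"
proof -
  have "\<Prod>S dvd (\<Prod>p\<in>prime_factors n. p ^ multiplicity p n)"
  proof (rule prod_dvd_prod_subset2)
    show "p dvd p ^ multiplicity p n" if "p \<in> S" for p
      using assms that by (auto simp: prime_factors_multiplicity intro!: dvd_power)
  qed (use assms(2) in auto)
  also have "\<dots> = n"
    using assms(1) by (simp add: prod_prime_factors)
  finally show ?thesis .
qed

text \<open>A squarefree number is determined by its set of primes, so \<open>Prod\<close> and
  \<open>prime_factors\<close> are mutually inverse here.\<close>

lemma bij_betw_squarefree_divisors:
  fixes n :: nat
  assumes "n > 0"
  shows "bij_betw Prod (Pow (prime_factors n)) {e. e dvd n \<and> squarefree e}"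
proof (rule bij_betw_byWitness[where f' = prime_factors])
  show "\<forall>S\<in>Pow (prime_factors n). prime_factors (\<Prod>S) = S"
    by (auto intro!: prime_factors_prod_primes intro: finite_subset)
  show "\<forall>e\<in>{e. e dvd n \<and> squarefree e}. \<Prod>(prime_factors e) = e"
    by (auto intro: prod_prime_factors_squarefree)
  show "Prod ` Pow (prime_factors n) \<subseteq> {e. e dvd n \<and> squarefree e}"
    using assms by (auto intro!: prod_primes_dvd squarefree_prod_primes)
  show "prime_factors ` {e. e dvd n \<and> squarefree e} \<subseteq> Pow (prime_factors n)"
    using assms dvd_prime_factors[of n] by auto
qed

section \<open>Size and sum of the two divisor sets\<close>

lemma D_plus_Un_D_minus: "D_plus n \<union> D_minus n = {m. m dvd n \<and> squarefree (n div m)}"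
  by (auto simp: D_plus_def D_minus_def moebius_def minus_one_power_iff)

lemma D_plus_Int_D_minus: "D_plus n \<inter> D_minus n = {}"
  by (auto simp: D_plus_def D_minus_def)

lemma finite_D_plus: "n > 0 \<Longrightarrow> finite (D_plus n)"
  and finite_D_minus: "n > 0 \<Longrightarrow> finite (D_minus n)"
  by (auto simp: D_plus_def D_minus_def)

text \<open>Taking the codivisor is an involution on the divisors of \<open>n\<close>; it is
  composed with the subset description of squarefree divisors. The same parametrization serves both
  for counting and for rewriting sums.\<close>

lemma bij_betw_D_plus_Un_D_minus:
  assumes "n > 0"
  shows "bij_betw (\<lambda>S. n div \<Prod>S) (Pow (prime_factors n)) (D_plus n \<union> D_minus n)"
proof -
  have "bij_betw (\<lambda>e. n div e) {e. e dvd n \<and> squarefree e} (D_plus n \<union> D_minus n)"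
    unfolding D_plus_Un_D_minus
    by (rule bij_betw_byWitness[where f' = "\<lambda>m. n div m"])
       (use assms in \<open>auto simp: div_div_eq_right\<close>)
  from bij_betw_trans[OF bij_betw_squarefree_divisors[OF assms] this] show ?thesis
    by (simp add: o_def)
qed

lemma card_D_plus_D_minus:
  assumes "n > 0"
  shows "card (D_plus n) + card (D_minus n) = 2 ^ card (prime_factors n)"
proof -
  have "card (D_plus n) + card (D_minus n) = card (D_plus n \<union> D_minus n)"
    using assms by (simp add: card_Un_disjoint finite_D_plus finite_D_minus D_plus_Int_D_minus)
  also have "\<dots> = card (Pow (prime_factors n))"
    using bij_betw_same_card[OF bij_betw_D_plus_Un_D_minus[OF assms]] by simp
  finally show ?thesis
    by (simp add: card_Pow)
qed

lemma moebius_prod_primes: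
  assumes "finite S" and "\<And>p. p \<in> S \<Longrightarrow> prime p"
  shows "moebius (\<Prod>S) = (-1) ^ card S"
  using assms by (simp add: moebius_def squarefree_prod_primes prime_factors_prod_primes)

text \<open>Expanding the product on the right over subsets \<open>S\<close> gives the terms
  \<open>(-1) ^ card S * n / \<Prod>S\<close>, whose sign tells which of the two sets contains
  \<open>n div \<Prod>S\<close>. The right-hand side is Euler's totient of \<open>n\<close>.\<close>

lemma sum_D_plus_diff_sum_D_minus:
  assumes "n > 0"
  shows "(\<Sum>m\<in>D_plus n. real m) - (\<Sum>m\<in>D_minus n. real m)
           = real n * (\<Prod>p\<in>prime_factors n. 1 - 1 / real p)"
proof -
  have "(\<Sum>m\<in>D_plus n. real m) - (\<Sum>m\<in>D_minus n. real m)
      = (\<Sum>m\<in>D_plus n \<union> D_minus n. moebius (n div m) * real m)"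
    using assms
    by (subst sum.union_disjoint)
       (auto simp: finite_D_plus finite_D_minus D_plus_Int_D_minus D_plus_def D_minus_def sum_negf)
  also have "\<dots> = (\<Sum>S\<in>Pow (prime_factors n). moebius (n div (n div \<Prod>S)) * real (n div \<Prod>S))"
    by (rule sum.reindex_bij_betw[OF bij_betw_D_plus_Un_D_minus[OF assms], symmetric])
  also have "\<dots> = (\<Sum>S\<in>Pow (prime_factors n). n * ((-1) ^ card S * (\<Prod>p\<in>S. 1 / real p)))"
  proof (rule sum.cong)
    fix S assume S: "S \<in> Pow (prime_factors n)"
    then have dvd: "\<Prod>S dvd n" and "finite S" and "\<And>p. p \<in> S \<Longrightarrow> prime p"
      using assms prod_primes_dvd by (auto intro: finite_subset)
    then have "moebius (\<Prod>S) = (-1) ^ card S"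
      by (intro moebius_prod_primes)
    moreover have "n div (n div \<Prod>S) = \<Prod>S"
      using dvd assms by (simp add: div_div_eq_right)
    ultimately show "moebius (n div (n div \<Prod>S)) * real (n div \<Prod>S)
        = n * ((-1) ^ card S * (\<Prod>p\<in>S. 1 / real p))"
      using dvd by (simp add: real_of_nat_div prod_dividef)
  qed simp
  \<comment> \<open>\<open>prod_diff_conv_sum\<close> is the subset expansion of a product of
    differences, read from right to left in effect.\<close>
  also have "\<dots> = real n * (\<Prod>p\<in>prime_factors n. 1 - 1 / real p)"
    by (simp add: prod_diff_conv_sum sum_distrib_left)
  finally show ?thesis .
qed

lemma sum_D_minus_le_sum_D_plus:
  assumes "n > 0"
  shows "\<Sum>(D_minus n) \<le> \<Sum>(D_plus n)"
proof -
  have "(\<Prod>p\<in>prime_factors n. 1 - 1 / real p) \<ge> 0"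
    by (rule prod_nonneg) (auto dest!: in_prime_factors_imp_prime prime_gt_0_nat)
  then have "(\<Sum>m\<in>D_minus n. real m) \<le> (\<Sum>m\<in>D_plus n. real m)"
    using sum_D_plus_diff_sum_D_minus[OF assms] by (smt (verit) mult_nonneg_nonneg of_nat_0_le_iff)
  then show ?thesis
    by (simp flip: of_nat_sum)
qed

section \<open>Size of the roots and of their power products\<close>

lemma member_le_prod_list:
  fixes xs :: "real list"
  assumes "\<forall>x\<in>set xs. 1 \<le> x" and "x \<in> set xs"
  shows "x \<le> prod_list xs"
  using assms
proof (induction xs)
  case (Cons y ys)
  have "1 \<le> prod_list ys"
    using Cons.prems by (intro prod_list_ge1) auto
  show ?case
  proof (cases "x = y")
    case True
    with \<open>1 \<le> prod_list ys\<close> Cons.prems(1) show ?thesis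
      using mult_left_mono[of 1 "prod_list ys" y] by simp
  next
    case False
    with Cons have "x \<le> prod_list ys" and "1 \<le> y"
      by auto
    with \<open>1 \<le> prod_list ys\<close> show ?thesis
      using mult_right_mono[of 1 y "prod_list ys"] by (simp add: order_trans)
  qed
qed simp

text \<open>For monic \<open>P\<close> the Mahler measure is exactly the product of the factors
  \<open>max 1 (cmod a)\<close>. All of them are at least 1, so none exceeds the product.\<close>

lemma norm_root_le_mahler_measure:
  assumes "lead_coeff P = 1" and "z \<in> set (complex_roots_int P)"
  shows "cmod z \<le> mahler_measure P"
proof -
  have "max 1 (cmod z) \<le> (\<Prod>a\<leftarrow>complex_roots_int P. max 1 (cmod a))"
    using assms(2) by (intro member_le_prod_list) auto
  also have "\<dots> = mahler_measure P"
    using assms(1) by (simp add: mahler_measure_def mahler_measure_poly_def complex_roots_int_def)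
  finally show ?thesis
    by simp
qed

definition root_power_product :: "int poly \<Rightarrow> nat multiset \<Rightarrow> (nat \<Rightarrow> nat) \<Rightarrow> complex" where
  "root_power_product P N j =
     (\<Prod>i<(size N). (complex_roots_int P ! j i) ^ (sorted_list_of_multiset N ! i))"

text \<open>Each linear factor contributes one root. Index functions with equal values yield
  repeated elements of the image multiset, so multiplicities are kept.\<close>

lemma proots_power_product_poly:
  "proots (power_product_poly P N) =
     image_mset (root_power_product P N) (mset_set ({..<size N} \<rightarrow>\<^sub>E {..<degree P}))"
proof -
  have "proots (power_product_poly P N) =
      (\<Sum>j\<in>{..<size N} \<rightarrow>\<^sub>E {..<degree P}. {#root_power_product P N j#})"
    unfolding power_product_poly_def Let_def root_power_product_def
    by (subst proots_prod) (simp_all only: proots_linear_factor minus_minus, simp)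
  also have "\<dots> = image_mset (root_power_product P N) (mset_set ({..<size N} \<rightarrow>\<^sub>E {..<degree P}))"
    by (simp add: sum_unfold_sum_mset)
  finally show ?thesis .
qed

lemma norm_root_power_product_le:
  assumes "lead_coeff P = 1" and "j \<in> {..<size N} \<rightarrow>\<^sub>E {..<degree P}"
  shows "cmod (root_power_product P N j) \<le> mahler_measure P ^ (\<Sum>\<^sub># N)"
proof -
  let ?ns = "sorted_list_of_multiset N"
  have len: "length ?ns = size N"
    by (metis mset_sorted_list_of_multiset size_mset)
  have "cmod (root_power_product P N j) \<le> (\<Prod>i<(size N). mahler_measure P ^ (?ns ! i))"
    unfolding root_power_product_def
  proof (subst prod_norm[symmetric], rule prod_mono, safe)
    fix i assume "i < size N"
    \<comment> \<open>The root list has length \<open>degree P\<close>, so the lookup stays inside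
      it and yields a root.\<close>
    then have "j i < length (complex_roots_int P)"
      using assms(2) by (auto simp: complex_roots_int(2))
    then have "cmod (complex_roots_int P ! j i) \<le> mahler_measure P"
      by (intro norm_root_le_mahler_measure[OF assms(1)]) simp
    then show "cmod ((complex_roots_int P ! j i) ^ (?ns ! i)) \<le> mahler_measure P ^ (?ns ! i)"
      by (simp add: norm_power power_mono)
  qed simp
  also have "\<dots> = mahler_measure P ^ (\<Sum>i<(size N). ?ns ! i)"
    by (simp add: power_sum)
  also have "(\<Sum>i<(size N). ?ns ! i) = sum_list ?ns"
    by (simp add: sum_list_sum_nth len atLeast0LessThan)
  also have "\<dots> = \<Sum>\<^sub># N"
    by (metis mset_sorted_list_of_multiset sum_mset_sum_list)
  finally show ?thesis .
qed

section \<open>Bounding the resultant\<close>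

lemma norm_monic_res_power_product_poly_le:
  assumes "lead_coeff P = 1" and "\<Sum>\<^sub># N' \<le> \<Sum>\<^sub># N"
  shows "cmod (monic_res (power_product_poly P N) (power_product_poly P N'))
           \<le> (2 * mahler_measure P ^ (\<Sum>\<^sub># N)) ^ (degree P ^ (size N + size N'))"
proof -
  let ?J = "{..<size N} \<rightarrow>\<^sub>E {..<degree P}" and ?K = "{..<size N'} \<rightarrow>\<^sub>E {..<degree P}"
  let ?a = "root_power_product P N" and ?b = "root_power_product P N'"
  let ?C = "mahler_measure P ^ (\<Sum>\<^sub># N)"
  have "P \<noteq> 0"
    using assms(1) by auto
  \<comment> \<open>This makes powers of the Mahler measure monotone in the exponent, so one
    constant \<open>?C\<close> bounds both kinds of roots.\<close>
  then have M: "1 \<le> mahler_measure P"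
    by (rule mahler_measure_poly_ge_1)
  have le: "cmod (?a j - ?b k) \<le> 2 * ?C" if "j \<in> ?J" "k \<in> ?K" for j k
  proof -
    have "cmod (?a j - ?b k) \<le> cmod (?a j) + cmod (?b k)"
      by (rule norm_triangle_ineq4)
    also have "cmod (?b k) \<le> mahler_measure P ^ (\<Sum>\<^sub># N')"
      by (rule norm_root_power_product_le[OF assms(1) that(2)])
    also have "\<dots> \<le> ?C"
      by (rule power_increasing[OF assms(2) M])
    finally show ?thesis
      using norm_root_power_product_le[OF assms(1) that(1)] by simp
  qed
  have "monic_res (power_product_poly P N) (power_product_poly P N')
      = (\<Prod>j\<in>?J. \<Prod>k\<in>?K. ?a j - ?b k)"
    by (simp add: monic_res_def proots_power_product_poly prod_unfold_prod_mset
        image_mset.compositionality o_def)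
  then have "cmod (monic_res (power_product_poly P N) (power_product_poly P N'))
      = (\<Prod>j\<in>?J. \<Prod>k\<in>?K. cmod (?a j - ?b k))"
    by (simp add: prod_norm)
  also have "\<dots> \<le> (\<Prod>j\<in>?J. \<Prod>k\<in>?K. 2 * ?C)"
    by (intro prod_mono conjI prod_nonneg le) auto
  \<comment> \<open>The index sets have \<open>degree P ^ size N\<close> and
    \<open>degree P ^ size N'\<close> elements, and the nested constant products multiply these
    counts.\<close>
  also have "\<dots> = (2 * ?C) ^ (degree P ^ (size N + size N'))"
    by (simp only: prod_constant card_funcsetE finite_lessThan card_lessThan power_add
        mult.commute flip: power_mult)
  finally show ?thesis .
qed

theorem theorem4p10:
  fixes P :: "int poly" and d n l :: nat
  assumes "lead_coeff P = 1" and "degree P = d"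
    and "n > 1" and "card (prime_factors n) = l"
  shows "cmod (U P n) \<le> 2 ^ (d ^ (2 ^ l)) * mahler_measure P ^ (d ^ (2 ^ l) * (\<Sum>m\<in>D_plus n. m))"
proof -
  have n: "n > 0"
    using assms(3) by simp
  have sums: "\<Sum>\<^sub># (mset_set (D_plus n)) = \<Sum>(D_plus n)" "\<Sum>\<^sub># (mset_set (D_minus n)) = \<Sum>(D_minus n)"
    by (simp_all add: sum_unfold_sum_mset)
  \<comment> \<open>\<open>D_plus n\<close> takes the role of \<open>N\<close>, the multiset with
    the larger sum. The two cardinalities in the exponent add up to \<open>2 ^ l\<close>.\<close>
  have "cmod (U P n) \<le> (2 * mahler_measure P ^ \<Sum>(D_plus n))
      ^ (d ^ (card (D_plus n) + card (D_minus n)))"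
    using norm_monic_res_power_product_poly_le[OF assms(1), of "mset_set (D_minus n)" "mset_set (D_plus n)"]
      sum_D_minus_le_sum_D_plus[OF n] assms(2)
    by (simp add: U_def sums)
  also have "\<dots> = 2 ^ (d ^ (2 ^ l)) * mahler_measure P ^ (d ^ (2 ^ l) * (\<Sum>m\<in>D_plus n. m))"
    using card_D_plus_D_minus[OF n] assms(4)
    by (simp add: power_mult_distrib mult.commute flip: power_mult)
  finally show ?thesis .
qed

end
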